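(* Let $\mathcal G^0=(\mathcal V,\mathcal E^0)$ be a graph with $N$ vertices, let $p\in[0,1]$, and let $L_\sigma$ be the random Laplacian of the graph obtained from $\mathcal G^0$ under Bernoulli packet loss with transmission probability $p$ (as defined in the context). Then $$\mathbb E[L_\sigma]=p\,L(\mathcal G^0),$$ $$\mathbb E[L_\sigma^TL_\sigma]=p^2L(\mathcal G^0)^TL(\mathcal G^0)+p(1-p)\big(L(\mathcal G^0)+L(\mathcal G^{0T})\big).$$
   Context: Graphs: a (directed) graph $\mathcal G=(\mathcal V,\mathcal E)$ has vertex set $\mathcal V=\{v_1,\dots,v_N\}$ and edge set $\mathcal E\subset\mathcal V\times\mathcal V$ without self-loops; $e_{ij}=(v_j,v_i)$ is the edge from $v_j$ to $v_i$. The in-neighbourhood is $\mathcal N_i^-=\{v_j: e_{ij}\in\mathcal E\}$, with $d_i^-=|\mathcal N_i^-|$. The transpose $\mathcal G^T=(\mathcal V,\mathcal E^T)$ has every edge reversed: $e_{ij}\in\mathcal E\Leftrightarrow e_{ji}\in\mathcal E^T$; $\mathcal G^{0T}=(\mathcal G^0)^T$. The Laplacian $L(\mathcal G)=[l_{ij}]$ has $l_{ij}=-1$ if $i\ne j$ and $v_j\in\mathcal N_i^-$, $l_{ij}=0$ if $i\neq j$ and $v_j\notin\mathcal N_i^-$, and $l_{ii}=d_i^-$. Packet loss model: to each edge $e_{ij}\in\mathcal E^0$ is attached a stationary process $\alpha_{ij}(k)\in\{0,1\}$, $k\ge0$ ($1$: packet transmitted, $0$: packet lost), with $\Pr(\alpha_{ij}(k)=1)=p$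 and $\Pr(\alpha_{ij}(k)=0)=1-p$. The variables $\alpha_{ij}(k)$ and $\alpha_{rs}(k')$ are independent whenever $k\ne k'$ or [$(r,s)\neq(i,j)$ and $(r,s)\ne(j,i)$]. (In particular $\alpha_{ij}(k)$ and $\alpha_{ji}(k)$ may be correlated.) The random Laplacian $L_{\sigma(k)}=[l^\sigma_{ij}(k)]$ is, with $\mathcal N_i^-$ the in-neighbourhoods in $\mathcal G^0$: $l^\sigma_{ij}(k)=-\alpha_{ij}(k)$ if $i\neq j$ and $v_j\in\mathcal N_i^-$; $l^\sigma_{ij}(k)=0$ if $i\ne j$ and $v_j\notin\mathcal N_i^-$; $l^\sigma_{ii}(k)=\sum_{v_m\in\mathcal N_i^-}\alpha_{im}(k)$. By stationarity the time index $k$ is dropped, and $L_\sigma$ denotes $L_{\sigma(k)}$ at any fixed time. *)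

theory Defs
  imports "HOL-Probability.Probability"
begin

text \<open>
  The vertices are the elements of the finite type \<^typ>\<open>'n\<close>, and a graph is given by its
  edge relation: \<open>(j, i) \<in> E\<close> is the edge \<open>e\<^sub>i\<^sub>j\<close> from \<open>j\<close> to \<open>i\<close>. The transpose graph is
  \<open>E\<inverse>\<close>.
\<close>

definition in_nbhd :: "('n \<times> 'n) set \<Rightarrow> 'n \<Rightarrow> 'n set" where
  "in_nbhd E i = {j. (j, i) \<in> E}"

definition laplacian :: "('n::finite \<times> 'n) set \<Rightarrow> real^'n^'n" where
  "laplacian E = (\<chi> i j. if i = j then real (card (in_nbhd E i))
                         else if j \<in> in_nbhd E i then - 1 else 0)"

definition lossy_laplacian :: "('n::finite \<times> 'n) set \<Rightarrow> ('n \<Rightarrow> 'n \<Rightarrow> real) \<Rightarrow> real^'n^'n" where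
  "lossy_laplacian E a = (\<chi> i j. if i = j then (\<Sum>m\<in>in_nbhd E i. a i m)
                                 else if j \<in> in_nbhd E i then - a i j else 0)"

definition stationary_process :: "'w measure \<Rightarrow> (nat \<Rightarrow> 'w \<Rightarrow> real) \<Rightarrow> bool" where
  "stationary_process M X \<longleftrightarrow>
     (\<forall>k. X k \<in> borel_measurable M) \<and>
     (\<forall>h. distr M (Pi\<^sub>M UNIV (\<lambda>_. borel)) (\<lambda>\<omega> k. X (k + h) \<omega>) =
          distr M (Pi\<^sub>M UNIV (\<lambda>_. borel)) (\<lambda>\<omega> k. X k \<omega>))"

text \<open>
  \<open>\<alpha> i j k\<close> is the transmission indicator of the edge \<open>(j, i)\<close> at time \<open>k\<close>; it is
  unconstrained when \<open>(j, i) \<notin> E\<close>. Independence is pairwise, and nothing is assumed about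
  the joint law of \<open>\<alpha> i j k\<close> and \<open>\<alpha> j i k\<close>.
\<close>

locale packet_loss = prob_space M
  for M :: "'w measure" +
  fixes E :: "('n::finite \<times> 'n) set"
    and p :: real
    and \<alpha> :: "'n \<Rightarrow> 'n \<Rightarrow> nat \<Rightarrow> 'w \<Rightarrow> real"
  assumes stationary: "(j, i) \<in> E \<Longrightarrow> stationary_process M (\<alpha> i j)"
    and zero_one: "(j, i) \<in> E \<Longrightarrow> \<omega> \<in> space M \<Longrightarrow> \<alpha> i j k \<omega> \<in> {0, 1}"
    and prob_received: "(j, i) \<in> E \<Longrightarrow> prob {\<omega> \<in> space M. \<alpha> i j k \<omega> = 1} = p"
    and prob_lost: "(j, i) \<in> E \<Longrightarrow> prob {\<omega> \<in> space M. \<alpha> i j k \<omega> = 0} = 1 - p"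
    and indep: "(j, i) \<in> E \<Longrightarrow> (s, r) \<in> E \<Longrightarrow>
      k \<noteq> k' \<or> ((r, s) \<noteq> (i, j) \<and> (r, s) \<noteq> (j, i)) \<Longrightarrow>
      indep_var borel (\<alpha> i j k) borel (\<alpha> r s k')"

end

theory Submission imports Defs begin

text \<open>
  Row \<open>i\<close> of the random Laplacian is \<open>\<Sum>j\<in>N\<^sub>i. \<alpha>\<^sub>i\<^sub>j (e\<^sub>i - e\<^sub>j)\<close>, so \<open>L\<^sup>T L\<close> is the sum of
  \<open>\<alpha>\<^sub>i\<^sub>j \<alpha>\<^sub>i\<^sub>l (e\<^sub>i - e\<^sub>j) (e\<^sub>i - e\<^sub>l)\<^sup>T\<close> over pairs of edges with the same head \<open>i\<close>. Two such edges
  are never reverses of each other, as there are no self-loops; hence the possibly correlated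
  pairs never meet and \<open>E[\<alpha>\<^sub>i\<^sub>j \<alpha>\<^sub>i\<^sub>l] = p\<^sup>2 + p (1 - p) \<delta>\<^sub>j\<^sub>l\<close>. The first term gives
  \<open>p\<^sup>2 L\<^sup>T L\<close>, and the diagonal terms add up, edge by edge, to the Laplacian of the graph plus
  that of its transpose.
\<close>

definition edge_vec :: "'n::finite \<Rightarrow> 'n \<Rightarrow> real^'n" where
  "edge_vec i j = axis i 1 - axis j 1"

definition outer :: "real^'m \<Rightarrow> real^'n \<Rightarrow> real^'n^'m" where
  "outer x y = (\<chi> r c. x $ r * y $ c)"

lemma outer_nth [simp]: "outer x y $ r $ c = x $ r * y $ c"
  by (simp add: outer_def)

lemma edge_vec_nth: "edge_vec i j $ c = of_bool (c = i) - of_bool (c = j)"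
  by (simp add: edge_vec_def axis_def)

lemma not_in_own_in_nbhd: "irrefl E \<Longrightarrow> i \<notin> in_nbhd E i"
  by (simp add: in_nbhd_def irrefl_def)

text \<open>With all coefficients 1, the decompositions of \<open>lossy_laplacian\<close> below also
  serve for the deterministic Laplacian.\<close>

lemma laplacian_eq_lossy: "laplacian E = lossy_laplacian E (\<lambda>_ _. 1)"
  by (simp add: laplacian_def lossy_laplacian_def vec_eq_iff)

text \<open>In column \<open>i\<close> each \<open>edge_vec i j\<close> contributes 1 because
  \<open>j\<close> differs from \<open>i\<close>; a self-loop would enter the diagonal sum although
  \<open>edge_vec i i\<close> is zero.\<close>

lemma lossy_laplacian_row:
  assumes "irrefl E"
  shows "lossy_laplacian E a $ i = (\<Sum>j\<in>in_nbhd E i. a i j *\<^sub>R edge_vec i j)"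
proof -
  have "lossy_laplacian E a $ i $ c = (\<Sum>j\<in>in_nbhd E i. a i j * edge_vec i j $ c)" for c
    using not_in_own_in_nbhd[OF assms, of i]
    by (auto simp: lossy_laplacian_def edge_vec_nth right_diff_distrib sum_subtractf
        of_bool_def if_distrib[of "(*) _"] sum.delta' cong: if_cong)
  then show ?thesis
    by (simp add: vec_eq_iff)
qed

text \<open>Confines the randomness to scalar coefficients of fixed matrices, so that expectations
  can be taken term by term.\<close>

lemma lossy_laplacian_eq_sum:
  assumes "irrefl E"
  shows "lossy_laplacian E a =
    (\<Sum>i\<in>UNIV. \<Sum>j\<in>in_nbhd E i. a i j *\<^sub>R outer (axis i 1) (edge_vec i j))"
proof -
  have "(\<Sum>i\<in>UNIV. \<Sum>j\<in>in_nbhd E i. a i j * (axis i 1 $ r * edge_vec i j $ c))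
      = (\<Sum>i\<in>UNIV. if r = i then \<Sum>j\<in>in_nbhd E i. a i j * edge_vec i j $ c else 0)" for r c
    by (intro sum.cong) (auto simp: axis_def)
  then show ?thesis
    by (simp add: vec_eq_iff lossy_laplacian_row[OF assms])
qed

lemma lossy_laplacian_gram:
  assumes "irrefl E"
  shows "transpose (lossy_laplacian E a) ** lossy_laplacian E a =
    (\<Sum>i\<in>UNIV. \<Sum>j\<in>in_nbhd E i. \<Sum>l\<in>in_nbhd E i.
      (a i j * a i l) *\<^sub>R outer (edge_vec i j) (edge_vec i l))"
  by (simp add: vec_eq_iff matrix_matrix_mult_def transpose_def
      lossy_laplacian_row[OF assms] sum_product mult_ac)

lemma laplacian_plus_transpose:
  assumes "irrefl E"
  shows "laplacian E + laplacian (E\<inverse>) =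
    (\<Sum>i\<in>UNIV. \<Sum>j\<in>in_nbhd E i. outer (edge_vec i j) (edge_vec i j))"
proof -
  let ?e = "\<lambda>i j. of_bool ((j, i) \<in> E) :: real"
  have loop: "(i, i) \<notin> E" for i
    using assms by (simp add: irrefl_def)
  have "(laplacian E + laplacian (E\<inverse>)) $ r $ c =
    (\<Sum>i\<in>UNIV. \<Sum>j\<in>in_nbhd E i. outer (edge_vec i j) (edge_vec i j)) $ r $ c" for r c
  proof -
    \<comment> \<open>Indicators make both index ranges independent of each other, so edges can be
      collected by tail as well as by head.\<close>
    have "(\<Sum>i\<in>UNIV. \<Sum>j\<in>in_nbhd E i. edge_vec i j $ r * edge_vec i j $ c)
        = (\<Sum>i\<in>UNIV. \<Sum>j\<in>UNIV. ?e i j * (edge_vec i j $ r * edge_vec i j $ c))"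
      by (intro sum.cong refl sum.mono_neutral_cong_left) (auto simp: in_nbhd_def)
    \<comment> \<open>The product of the two differences of Kronecker deltas is expanded: two
      diagonal terms and two cross terms.\<close>
    also have "\<dots> = (\<Sum>i\<in>UNIV. \<Sum>j\<in>UNIV.
        (if i = r then of_bool (r = c) * ?e r j else 0)
        + (if j = r then of_bool (r = c) * ?e i r else 0)
        - (if i = r then if j = c then ?e r c else 0 else 0)
        - (if i = c then if j = r then ?e c r else 0 else 0))"
      by (intro sum.cong refl) (auto simp: edge_vec_nth loop)
    also have "\<dots> = of_bool (r = c) * (\<Sum>j\<in>UNIV. ?e r j)
        + of_bool (r = c) * (\<Sum>i\<in>UNIV. ?e i r) - ?e r c - ?e c r"
    proof -
      have pull: "(\<Sum>j\<in>UNIV. if P then f j else 0) = (if P then \<Sum>j\<in>UNIV. f j else 0)"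
        for P and f :: "'a \<Rightarrow> real"
        by simp
      show ?thesis
        by (simp add: sum.distrib sum_subtractf pull sum_distrib_left del: of_bool_eq_iff)
    qed
    \<comment> \<open>For \<open>r = c\<close> the sums are the in-degrees of \<open>r\<close> in
      \<open>E\<close> and \<open>E\<inverse>\<close>, and the cross terms vanish for lack of loops;
      otherwise only the cross terms remain.\<close>
    also have "\<dots> = (laplacian E + laplacian (E\<inverse>)) $ r $ c"
      by (auto simp: laplacian_def in_nbhd_def loop sum_of_bool_eq)
    finally show ?thesis
      by simp
  qed
  then show ?thesis
    by (simp add: vec_eq_iff)
qed

context packet_loss
begin

lemma measurable_alpha: "(j, i) \<in> E \<Longrightarrow> \<alpha> i j k \<in> borel_measurable M"
  using stationary by (simp add: stationary_process_def)

text \<open>On the space, \<open>\<alpha> i j k\<close> is the indicator of the event that it equals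
  1, which has probability \<open>p\<close>.\<close>

lemma has_bochner_integral_alpha:
  assumes "(j, i) \<in> E"
  shows "has_bochner_integral M (\<alpha> i j k) p"
proof -
  have "has_bochner_integral M (indicator {\<omega> \<in> space M. \<alpha> i j k \<omega> = 1}) p"
    using has_bochner_integral_real_indicator[of "{\<omega> \<in> space M. \<alpha> i j k \<omega> = 1}" M]
      measurable_alpha[OF assms] prob_received[OF assms]
    by (simp add: less_top[symmetric])
  moreover have "\<alpha> i j k \<omega> = indicator {\<omega> \<in> space M. \<alpha> i j k \<omega> = 1} \<omega>" if "\<omega> \<in> space M" for \<omega>
    using zero_one[OF assms that, of k] that by auto
  ultimately show ?thesis
    using has_bochner_integral_cong[OF refl _ refl] by blast
qed

lemma alpha_sq: "(j, i) \<in> E \<Longrightarrow> \<omega> \<in> space M \<Longrightarrow> \<alpha> i j k \<omega> * \<alpha> i j k \<omega> = \<alpha> i j k \<omega>"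
  using zero_one[of j i \<omega> k] by auto

text \<open>For \<open>l = j\<close> the product is \<open>\<alpha> i j k\<close> itself, with mean
  \<open>p\<close>, the sum of \<open>p\<^sup>2\<close> and \<open>p * (1 - p)\<close>; otherwise
  independence gives \<open>p\<^sup>2\<close>.\<close>

lemma has_bochner_integral_alpha_mult:
  assumes "irrefl E" "(j, i) \<in> E" "(l, i) \<in> E"
  shows "has_bochner_integral M (\<lambda>\<omega>. \<alpha> i j k \<omega> * \<alpha> i l k \<omega>)
    (p\<^sup>2 + (if l = j then p * (1 - p) else 0))"
proof (cases "l = j")
  case True
  then show ?thesis
    using has_bochner_integral_alpha[OF assms(2)]
    by (simp add: alpha_sq[OF assms(2)] power2_eq_square algebra_simps
        cong: has_bochner_integral_cong)
next
  case False
  \<comment> \<open>This excludes \<open>(i, l) = (j, i)\<close>, the reversed pair for which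
    \<open>indep\<close> gives nothing.\<close>
  have "i \<noteq> j"
    using assms by (auto simp: irrefl_def)
  then have "indep_var borel (\<alpha> i j k) borel (\<alpha> i l k)"
    using False by (intro indep assms) auto
  with False show ?thesis
    using has_bochner_integral_alpha[OF assms(2), of k]
      has_bochner_integral_alpha[OF assms(3), of k]
    by (simp add: has_bochner_integral_iff indep_var_integrable indep_var_lebesgue_integral
        power2_eq_square)
qed

lemma expectation_lossy_laplacian:
  assumes "irrefl E"
  shows "(\<integral>\<omega>. lossy_laplacian E (\<lambda>i j. \<alpha> i j k \<omega>) \<partial>M) = p *\<^sub>R laplacian E"
proof -
  have "has_bochner_integral M (\<lambda>\<omega>. lossy_laplacian E (\<lambda>i j. \<alpha> i j k \<omega>))
      (\<Sum>i\<in>UNIV. \<Sum>j\<in>in_nbhd E i. p *\<^sub>R outer (axis i 1) (edge_vec i j))"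
    unfolding lossy_laplacian_eq_sum[OF assms]
    by (intro has_bochner_integral_sum has_bochner_integral_scaleR_left
        has_bochner_integral_alpha) (simp add: in_nbhd_def)
  also have "(\<Sum>i\<in>UNIV. \<Sum>j\<in>in_nbhd E i. p *\<^sub>R outer (axis i 1) (edge_vec i j))
      = p *\<^sub>R laplacian E"
    by (simp add: laplacian_eq_lossy lossy_laplacian_eq_sum[OF assms] scaleR_sum_right)
  finally show ?thesis
    by (rule has_bochner_integral_integral_eq)
qed

lemma expectation_lossy_laplacian_gram:
  assumes "irrefl E"
  shows "(\<integral>\<omega>. transpose (lossy_laplacian E (\<lambda>i j. \<alpha> i j k \<omega>)) **
      lossy_laplacian E (\<lambda>i j. \<alpha> i j k \<omega>) \<partial>M) =
    p\<^sup>2 *\<^sub>R (transpose (laplacian E) ** laplacian E) +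
    (p * (1 - p)) *\<^sub>R (laplacian E + laplacian (E\<inverse>))"
proof -
  let ?C = "\<lambda>i j l. outer (edge_vec i j) (edge_vec i l)"
  let ?S = "\<Sum>i\<in>UNIV. \<Sum>j\<in>in_nbhd E i. \<Sum>l\<in>in_nbhd E i.
      (p\<^sup>2 + (if l = j then p * (1 - p) else 0)) *\<^sub>R ?C i j l"
  have "has_bochner_integral M (\<lambda>\<omega>. transpose (lossy_laplacian E (\<lambda>i j. \<alpha> i j k \<omega>)) **
      lossy_laplacian E (\<lambda>i j. \<alpha> i j k \<omega>)) ?S"
    unfolding lossy_laplacian_gram[OF assms]
    by (intro has_bochner_integral_sum has_bochner_integral_scaleR_left
        has_bochner_integral_alpha_mult assms) (simp_all add: in_nbhd_def)
  \<comment> \<open>Writing \<open>?C i j j\<close> in the conditional term leaves \<open>l\<close>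
    only in its condition, so the sum over \<open>l\<close> collapses.\<close>
  also have "?S = (\<Sum>i\<in>UNIV. \<Sum>j\<in>in_nbhd E i. \<Sum>l\<in>in_nbhd E i.
      p\<^sup>2 *\<^sub>R ?C i j l + (if l = j then (p * (1 - p)) *\<^sub>R ?C i j j else 0))"
    by (intro sum.cong refl) (simp add: scaleR_add_left)
  also have "\<dots> = p\<^sup>2 *\<^sub>R (transpose (laplacian E) ** laplacian E) +
      (p * (1 - p)) *\<^sub>R (laplacian E + laplacian (E\<inverse>))"
    unfolding laplacian_plus_transpose[OF assms]
    by (simp add: laplacian_eq_lossy lossy_laplacian_gram[OF assms] scaleR_sum_right
        sum.distrib)
  finally show ?thesis
    by (rule has_bochner_integral_integral_eq)
qed

end

theorem lemma4:
  fixes M :: "'w measure"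
    and E :: "('n::finite \<times> 'n) set"
    and p :: real
    and \<alpha> :: "'n \<Rightarrow> 'n \<Rightarrow> nat \<Rightarrow> 'w \<Rightarrow> real"
    and k :: nat
  defines "L\<^sub>\<sigma> \<equiv> \<lambda>\<omega>. lossy_laplacian E (\<lambda>i j. \<alpha> i j k \<omega>)"
  assumes "irrefl E"
    and "p \<in> {0..1}"
    and "packet_loss M E p \<alpha>"
  shows "(\<integral>\<omega>. L\<^sub>\<sigma> \<omega> \<partial>M) = p *\<^sub>R laplacian E \<and>
    (\<integral>\<omega>. transpose (L\<^sub>\<sigma> \<omega>) ** L\<^sub>\<sigma> \<omega> \<partial>M) =
      p\<^sup>2 *\<^sub>R (transpose (laplacian E) ** laplacian E) +
      (p * (1 - p)) *\<^sub>R (laplacian E + laplacian (E\<inverse>))"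
proof -
  interpret packet_loss M E p \<alpha>
    by fact
  show ?thesis
    unfolding L\<^sub>\<sigma>_def using expectation_lossy_laplacian[OF \<open>irrefl E\<close>]
      expectation_lossy_laplacian_gram[OF \<open>irrefl E\<close>] by blast
qed

end
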